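(* Let $\Sigma$ be a connected signed graph with Euler-genus spectrum $\mathcal S(\Sigma)$, let $d=\min\mathcal S(\Sigma)$ and $\gamma^E_M(\Sigma)=\max\mathcal S(\Sigma)$. If $\tau$ is the smallest integer such that $\tau\in\mathcal S(\Sigma)$ and $\tau+1\in\mathcal S(\Sigma)$ (assuming such an integer exists), then $$\mathcal S(\Sigma)=\{d,d+2,\ldots,\tau\}\cup\{\tau+1,\tau+2,\ldots,\gamma^E_M(\Sigma)\}.$$ Here $\{d,d+2,\ldots,\tau\}$ is the step-two interval from $d$ to $\tau$ (so $\tau\equiv d \pmod 2$), and $\{\tau+1,\tau+2,\ldots,\gamma^E_M(\Sigma)\}$ is the set of all integers from $\tau+1$ to $\gamma^E_M(\Sigma)$.
   Context: A signed graph $\Sigma=(G,\sigma)$ is a finite graph $G$ together with a map $\sigma:E(G)\to\{+1,-1\}$; it is connected if $G$ is. A cycle of $\Sigma$ is positive if it contains an even number of edges of sign $-1$, and negative otherwise. A surface is a compact (connected) 2-dimensional manifold without boundary, orientable or not. An embedding of a graph $G$ on a surface $S$ is an embedding (homeomorphism onto its image) $\rho:G\to S$ such that every component of $S-\rho(G)$ (a face) is a 2-cell. An embedding of the signed graph $\Sigma=(G,\sigma)$ is an embedding $\rho$ of $G$ on some surface $S$ such that a cycle $C$ of $\Sigma$ is positive if and only if $\rho(C)$ is orientation-preserving on $S$. (Equivalently, in the standard combinatorial encoding, an embedding is given by a rotation system of $G$ together with the edge signature $\sigma$, faces being obtained by the usual face-tracing procedure for embedding schemes.) With $f(\rho)$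 the number of faces, the Euler-genus of $\rho$ is $\gamma^E(\rho)=|E(G)|-|V(G)|+2-f(\rho)$. The Euler-genus spectrum of $\Sigma$ is $\mathcal S(\Sigma)=\{\gamma^E(\rho):\rho\text{ is an embedding of }\Sigma\}$. *)

theory Defs
  imports "Graph_Theory.Graph_Theory" "HOL-Combinatorics.Orbits"
begin

text \<open>
  A finite graph, loops and parallel edges allowed, is given by its darts: \<open>arcs G\<close> contains each
  edge once in each of its two directions, and \<open>arev\<close> exchanges the two directions. The signature
  \<open>\<sigma>\<close> is a function on edges, so it takes the same value on both darts of an edge; its values
  outside \<open>arcs G\<close> are irrelevant.
\<close>

locale signed_graph = fin_digraph G + bidirected_digraph G arev
  for G :: "('v, 'd) pre_digraph" and arev :: "'d \<Rightarrow> 'd" +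
  fixes \<sigma> :: "'d \<Rightarrow> int"
  assumes sign_values: "a \<in> arcs G \<Longrightarrow> \<sigma> a \<in> {1, -1}"
    and sign_arev: "a \<in> arcs G \<Longrightarrow> \<sigma> (arev a) = \<sigma> a"
begin

definition edges :: "'d set set" where
  "edges = {{a, arev a} | a. a \<in> arcs G}"

text \<open>
  An embedding is encoded by the embedding scheme \<open>(\<pi>, \<sigma>)\<close>: a local orientation is chosen at every
  vertex, \<open>\<pi>\<close> lists the darts leaving the vertex in the resulting cyclic order, and \<open>\<sigma> a = 1\<close> iff
  transport along \<open>a\<close> preserves the chosen orientations. So a cycle is orientation-preserving in
  the surface of the scheme iff it contains an even number of edges of sign \<open>-1\<close>.
\<close>

definition rotation_system :: "('d \<Rightarrow> 'd) \<Rightarrow> bool" where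
  "rotation_system \<pi> \<longleftrightarrow> \<pi> permutes arcs G \<and>
     (\<forall>v \<in> verts G. out_arcs G v \<noteq> {} \<longrightarrow> cyclic_on \<pi> (out_arcs G v))"

text \<open>
  Face tracing. In a state \<open>(a, s)\<close> the dart \<open>a\<close> is about to be traversed, and \<open>s\<close> tells whether
  the orientation carried along agrees with the one chosen at the tail of \<open>a\<close>. After the traversal,
  the next dart at the head of \<open>a\<close> is taken, in the sense of the carried orientation.
\<close>

definition states :: "('d \<times> int) set" where
  "states = arcs G \<times> {1, -1}"

definition face_step :: "('d \<Rightarrow> 'd) \<Rightarrow> 'd \<times> int \<Rightarrow> 'd \<times> int" where
  "face_step \<pi> = (\<lambda>(a, s). let t = s * \<sigma> a in
     ((if t = 1 then \<pi> else inv \<pi>) (arev a), t))"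

text \<open>
  The state in which the same side of the same edge is followed in the opposite direction.
\<close>

definition reverse_state :: "'d \<times> int \<Rightarrow> 'd \<times> int" where
  "reverse_state = (\<lambda>(a, s). (arev a, - (s * \<sigma> a)))"

text \<open>
  A facial walk and its reverse bound the same face, so the orbits of \<open>face_step \<pi>\<close> are merged in
  pairs.
\<close>

definition face_of :: "('d \<Rightarrow> 'd) \<Rightarrow> 'd \<times> int \<Rightarrow> ('d \<times> int) set" where
  "face_of \<pi> x = orbit (face_step \<pi>) x \<union> orbit (face_step \<pi>) (reverse_state x)"

text \<open>
  The second summand is nonzero for a connected graph only if the graph is a single vertex without
  edges; its embedding in the sphere has one face, which face tracing does not see.
\<close>

definition num_faces :: "('d \<Rightarrow> 'd) \<Rightarrow> nat" where
  "num_faces \<pi> = card (face_of \<pi> ` states) + card {v \<in> verts G. out_arcs G v = {}}"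

definition euler_genus :: "('d \<Rightarrow> 'd) \<Rightarrow> int" where
  "euler_genus \<pi> = int (card edges) - int (card (verts G)) + 2 - int (num_faces \<pi>)"

definition genus_spectrum :: "int set" where
  "genus_spectrum = {euler_genus \<pi> | \<pi>. rotation_system \<pi>}"

end

end

theory Submission
  imports Defs
begin

text \<open>
  Let \<open>\<rho>\<close> and \<open>\<xi>\<close> be rotation systems with \<open>\<rho> d \<noteq> \<xi> d\<close>. Moving a block of darts makes \<open>\<rho>\<close> agree with \<open>\<xi>\<close>
  at \<open>d\<close> without losing an agreement, and it changes the Euler genus by at most 2; so the spectrum
  has no two consecutive gaps. Suppose that \<open>k\<close> is a gap, that the genus of \<open>\<rho>\<close> exceeds \<open>k\<close> and that
  the genus of \<open>\<xi>\<close> is below \<open>k\<close> and has the parity of \<open>k\<close>. By induction on the number of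
  disagreements, every such move leads from \<open>\<rho>\<close> below \<open>k\<close>, so it lowers the genus from \<open>k + 1\<close> to
  \<open>k - 1\<close>, that is, it splits one facial walk into three. Then the corners at which \<open>\<rho>\<close> and \<open>\<xi>\<close>
  differ are permuted by \<open>\<rho>\<inverse>\<xi>\<close> within coherently directed facial walks of \<open>\<rho>\<close>. The permutation
  \<open>\<rho>\<inverse>\<xi>\<close> is even, because \<open>\<rho>\<close> and \<open>\<xi>\<close> have the same orbits, so the numbers of faces of \<open>\<rho>\<close> and \<open>\<xi>\<close>
  have the same parity, a contradiction. Hence no gap lies above two numbers of the spectrum of
  different parity and below a third one.
\<close>

section \<open>Orbits of a permutation and transpositions\<close>

definition num_orbits :: "('a \<Rightarrow> 'a) \<Rightarrow> 'a set \<Rightarrow> nat" where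
  "num_orbits p S = card (orbit p ` S)"

lemma permutes_permutation: "p permutes S \<Longrightarrow> finite S \<Longrightarrow> permutation p"
  by (auto simp: permutation_permutes)

lemma permutation_orbit_eq:
  assumes "permutation p" "y \<in> orbit p x"
  shows "orbit p y = orbit p x"
  using orbit_cyclic_eq3[OF cyclic_on_orbit'[OF assms(1)] assms(2)] .

lemma orbit_subset_closed:
  assumes "x \<in> A" "\<And>y. y \<in> A \<Longrightarrow> p y \<in> A"
  shows "orbit p x \<subseteq> A"
proof
  fix y assume "y \<in> orbit p x"
  then show "y \<in> A"
    by induct (use assms in auto)
qed

lemma orbit_transpose_other:
  assumes p: "permutation p" and x: "a \<notin> orbit p x" "b \<notin> orbit p x"
  shows "orbit (p \<circ> Transposition.transpose a b) x = orbit p x"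
proof (rule orbit_cong)
  show "x \<in> orbit p x"
    using p by (rule permutation_self_in_orbit)
  fix s assume "s \<in> orbit p x"
  then have "s \<noteq> a" "s \<noteq> b"
    using x by auto
  then show "(p \<circ> Transposition.transpose a b) s = p s"
    by simp
qed

text \<open>The new permutation goes from \<open>a\<close> to \<open>p b\<close>, follows the old
  cycle of \<open>b\<close> up to \<open>b\<close>, jumps from there to \<open>p a\<close> and
  follows the old cycle of \<open>a\<close> back to \<open>a\<close>.\<close>

lemma orbit_transpose_merge:
  assumes p: "permutation p" and ab: "b \<notin> orbit p a"
  shows "orbit (p \<circ> Transposition.transpose a b) a = orbit p a \<union> orbit p b"
    (is "orbit ?q a = ?A \<union> ?B")
proof
  have a: "a \<in> ?A" and b: "b \<in> ?B"
    using p by (auto intro: permutation_self_in_orbit)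
  have disj: "?A \<inter> ?B = {}"
    using ab b permutation_orbit_eq[OF p] by blast
  have q: "?q a = p b" "?q b = p a" "\<And>y. y \<noteq> a \<Longrightarrow> y \<noteq> b \<Longrightarrow> ?q y = p y"
    by simp_all
  show "orbit ?q a \<subseteq> ?A \<union> ?B"
  proof (rule orbit_subset_closed)
    fix y assume "y \<in> ?A \<union> ?B"
    then show "?q y \<in> ?A \<union> ?B"
      using orbit.step[of y p] orbit.base[of p a] orbit.base[of p b] q
      by (cases "y = a"; cases "y = b") auto
  qed (use a in simp)
  have B: "?B \<subseteq> orbit ?q a"
  proof
    fix y assume "y \<in> ?B"
    then show "y \<in> orbit ?q a"
    proof induct
      case base
      then show ?case
        using orbit.base[of ?q a] q(1) by metis
    next
      case (step y)
      show ?case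
      proof (cases "y = b")
        case True
        then show ?thesis
          using orbit.base[of ?q a] q(1) by metis
      next
        case False
        moreover have "y \<noteq> a"
          using step(1) a disj by auto
        ultimately show ?thesis
          using orbit.step[OF step(2)] q(3) by metis
      qed
    qed
  qed
  have "?A \<subseteq> orbit ?q a"
  proof
    have pa: "p a \<in> orbit ?q a"
      using orbit.step[of b ?q a] B b q(2) by (metis subsetD)
    fix y assume "y \<in> ?A"
    then show "y \<in> orbit ?q a"
    proof induct
      case base
      then show ?case
        by (rule pa)
    next
      case (step y)
      show ?case
      proof (cases "y = a")
        case True
        then show ?thesis
          using pa by (simp only:)
      next
        case False
        moreover have "y \<noteq> b"
          using step(1) b disj by auto
        ultimately show ?thesis
          using orbit.step[OF step(2)] q(3) by metis
      qed
    qed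
  qed
  with B show "?A \<union> ?B \<subseteq> orbit ?q a"
    by simp
qed

text \<open>After the exchange \<open>b\<close> is sent to \<open>p a\<close>, so the segment from
  \<open>p a\<close> to \<open>b\<close> closes up before \<open>a\<close> is reached.\<close>

lemma orbit_transpose_split:
  assumes p: "permutation p" and ab: "b \<in> orbit p a" "a \<noteq> b"
  shows "a \<notin> orbit (p \<circ> Transposition.transpose a b) b"
proof
  let ?q = "p \<circ> Transposition.transpose a b"
  obtain n where n: "(p ^^ n) a = b" "0 < n"
    and least: "\<And>i. 0 < i \<Longrightarrow> i < n \<Longrightarrow> (p ^^ i) a \<noteq> b"
  proof (rule that)
    show "(p ^^ funpow_dist1 p a b) a = b"
      using ab(1) by (rule funpow_dist1_prop)
    show "0 < funpow_dist1 p a b"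
      by (rule zero_less_Suc)
    show "(p ^^ i) a \<noteq> b" if "0 < i" "i < funpow_dist1 p a b" for i
      using that by (rule funpow_dist1_least)
  qed
  \<comment> \<open>\<open>T\<close> is the segment from \<open>p a\<close> to the first visit to
    \<open>b\<close>. By minimality of \<open>n\<close> it avoids \<open>a\<close>: an earlier
    return to \<open>a\<close> would bring an earlier visit to \<open>b\<close>.\<close>
  define T where "T = (\<lambda>i. (p ^^ i) a) ` {1..n}"
  have T: "y \<in> T \<longleftrightarrow> (\<exists>i. 1 \<le> i \<and> i \<le> n \<and> (p ^^ i) a = y)" for y
    by (auto simp: T_def)
  have a_T: "a \<notin> T"
  proof
    assume "a \<in> T"
    then obtain i where i: "(p ^^ i) a = a" "1 \<le> i" "i \<le> n"
      unfolding T by blast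
    have "i \<noteq> n"
      using i(1) n(1) ab(2) by auto
    have "(p ^^ (n - i)) a = (p ^^ (n - i)) ((p ^^ i) a)"
      by (simp only: i)
    also have "\<dots> = (p ^^ n) a"
      using i(3) funpow_add[of "n - i" i p] by simp
    finally show False
      using least[of "n - i"] \<open>i \<noteq> n\<close> i(2,3) n by simp
  qed
  have "orbit ?q b \<subseteq> T"
  proof (rule orbit_subset_closed)
    show "b \<in> T"
      unfolding T using n by (intro exI[where x = n]) simp
    fix y assume y: "y \<in> T"
    then obtain i where i: "(p ^^ i) a = y" "1 \<le> i" "i \<le> n"
      unfolding T by blast
    show "?q y \<in> T"
    proof (cases "y = b")
      case True
      then have "?q y = (p ^^ 1) a"
        by simp
      then show ?thesis
        unfolding T using n(2) by (intro exI[where x = 1]) simp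
    next
      case False
      then have "i \<noteq> n"
        using i(1) n(1) by auto
      have "y \<noteq> a"
        using y a_T by auto
      then have "?q y = (p ^^ Suc i) a"
        using False by (simp add: i(1))
      then show ?thesis
        unfolding T using i(2,3) \<open>i \<noteq> n\<close> by (intro exI[where x = "Suc i"]) simp
    qed
  qed
  moreover assume "a \<in> orbit ?q b"
  ultimately show False
    using a_T by auto
qed

section \<open>Number of orbits and sign under transpositions\<close>

lemma transpose_cancel: "p \<circ> Transposition.transpose a b \<circ> Transposition.transpose a b = p"
  by (simp add: fun_eq_iff)

lemma num_orbits_merge:
  assumes p: "p permutes S" "finite S" and ab: "a \<in> S" "b \<in> S" "b \<notin> orbit p a"
  shows "Suc (num_orbits (p \<circ> Transposition.transpose a b) S) = num_orbits p S"
proof -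
  let ?q = "p \<circ> Transposition.transpose a b" and ?A = "orbit p a" and ?B = "orbit p b"
  have pp: "permutation p" and qq: "permutation ?q"
    using p by (auto intro!: permutes_permutation permutation_compose permutation_swap_id)
  note self = permutation_self_in_orbit[OF pp] and eq = permutation_orbit_eq[OF pp]
  have const: "f ` X = {c}" if "\<And>x. x \<in> X \<Longrightarrow> f x = c" "y \<in> X" for f :: "'a \<Rightarrow> 'a set" and X c y
    using that by auto
  \<comment> \<open>The orbits in \<open>?R\<close> occur before and after the change, so the counts
    differ only by \<open>?A\<close> and \<open>?B\<close> against their union.\<close>
  let ?R = "orbit p ` (S - (?A \<union> ?B))"
  have merge: "orbit ?q a = ?A \<union> ?B"
    using pp ab(3) by (rule orbit_transpose_merge)
  have sub: "?A \<union> ?B \<subseteq> S"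
    using permutes_orbit_subset[OF p(1)] ab by simp
  have "orbit p ` S = ?R \<union> orbit p ` (?A \<union> ?B)"
    using sub by blast
  also have "orbit p ` (?A \<union> ?B) = {?A, ?B}"
    using const[OF eq self, of a] const[OF eq self, of b]
    by (simp add: image_Un insert_commute)
  finally have 1: "orbit p ` S = insert ?A (insert ?B ?R)"
    by simp
  have "orbit ?q ` S = orbit ?q ` (S - (?A \<union> ?B)) \<union> orbit ?q ` (?A \<union> ?B)"
    using sub by blast
  also have "orbit ?q ` (?A \<union> ?B) = {?A \<union> ?B}"
    using const[where f = "orbit ?q" and X = "?A \<union> ?B" and y = a and c = "?A \<union> ?B"]
      permutation_orbit_eq[OF qq, of _ a] self[of a] unfolding merge by blast
  also have "orbit ?q ` (S - (?A \<union> ?B)) = ?R"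
  proof (rule image_cong)
    fix x assume "x \<in> S - (?A \<union> ?B)"
    then have "a \<notin> orbit p x" "b \<notin> orbit p x"
      by (metis DiffD2 UnCI eq self)+
    then show "orbit ?q x = orbit p x"
      by (rule orbit_transpose_other[OF pp])
  qed simp
  finally have 2: "orbit ?q ` S = insert (?A \<union> ?B) ?R"
    by blast
  have "X \<notin> ?R" if "X \<subseteq> ?A \<union> ?B" for X
    using that self by fastforce
  moreover have "?A \<noteq> ?B"
    using self[of b] ab(3) by metis
  ultimately show ?thesis
    using p(2) by (simp add: num_orbits_def 1 2)
qed

text \<open>A split is a merge read backwards: a second composition with the same transposition
  restores \<open>p\<close>.\<close>

lemma num_orbits_split:
  assumes p: "p permutes S" "finite S" and ab: "a \<in> S" "b \<in> S" "a \<noteq> b" "b \<in> orbit p a"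
  shows "num_orbits (p \<circ> Transposition.transpose a b) S = Suc (num_orbits p S)"
proof -
  let ?q = "p \<circ> Transposition.transpose a b"
  have q: "?q permutes S"
    using p ab by (intro permutes_compose permutes_swap_id)
  have "b \<notin> orbit ?q a"
    using orbit_transpose_split[OF permutes_permutation[OF p] ab(4,3)]
      permutation_orbit_eq[OF permutes_permutation[OF q p(2)]]
      permutation_self_in_orbit[OF permutes_permutation[OF q p(2)]] by blast
  from num_orbits_merge[OF q p(2) ab(1,2) this] show ?thesis
    by (simp add: transpose_cancel)
qed

lemma orbit_transpose_split_Un:
  assumes p: "permutation p" and ab: "b \<in> orbit p a" "a \<noteq> b"
  shows "orbit (p \<circ> Transposition.transpose a b) a \<union> orbit (p \<circ> Transposition.transpose a b) b
    = orbit p a"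
proof -
  let ?q = "p \<circ> Transposition.transpose a b"
  have q: "permutation ?q"
    using p by (intro permutation_compose permutation_swap_id)
  have "b \<notin> orbit ?q a"
    using orbit_transpose_split[OF p ab] permutation_orbit_eq[OF q]
      permutation_self_in_orbit[OF q] by blast
  from orbit_transpose_merge[OF q this] show ?thesis
    by (simp add: transpose_cancel)
qed

text \<open>A transposition merges two orbits or splits one, and changes nothing if
  \<open>a = b\<close>. An orbit can therefore be gained only by a split, which needs
  \<open>a\<close> and \<open>b\<close> in one orbit.\<close>

lemma num_orbits_transpose_cases:
  assumes p: "p permutes S" "finite S" and ab: "a \<in> S" "b \<in> S"
  shows "\<bar>int (num_orbits (p \<circ> Transposition.transpose a b) S) - int (num_orbits p S)\<bar> \<le> 1"
    and "int (num_orbits (p \<circ> Transposition.transpose a b) S) = int (num_orbits p S) + 1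
      \<Longrightarrow> b \<in> orbit p a"
proof -
  have same: "p \<circ> Transposition.transpose a b = p" if "a = b"
    using that by (simp add: fun_eq_iff)
  show "\<bar>int (num_orbits (p \<circ> Transposition.transpose a b) S) - int (num_orbits p S)\<bar> \<le> 1"
    using num_orbits_merge[OF p ab] num_orbits_split[OF p ab] same
    by (cases "b \<in> orbit p a"; cases "a = b") simp_all
  show "b \<in> orbit p a"
    if "int (num_orbits (p \<circ> Transposition.transpose a b) S) = int (num_orbits p S) + 1"
    using that num_orbits_merge[OF p ab] by (cases "b \<in> orbit p a") simp_all
qed

text \<open>Every transposition flips the sign and changes the number of orbits by exactly one. The
  identity has \<open>card S\<close> orbits, which makes the exponent even.\<close>

lemma sign_eq_num_orbits:
  assumes "p permutes S" "finite S"
  shows "sign p = (- 1) ^ (card S + num_orbits p S)"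
  using assms(2,1)
proof (induction rule: permutes_rev_induct)
  case id
  have "orbit id x = {x}" for x :: 'a
    by (simp add: orbit_eq_singleton_iff)
  then have "orbit id ` S = (\<lambda>x. {x}) ` S"
    by simp
  then have "num_orbits id S = card S"
    by (simp add: num_orbits_def card_image)
  then show ?case
    by (simp only: sign_id) simp
next
  case (swap a b p)
  have "sign (p \<circ> Transposition.transpose a b) = - sign p"
    using swap assms(2)
    by (simp add: sign_compose permutes_permutation permutation_swap_id sign_swap_id)
  moreover have "num_orbits (p \<circ> Transposition.transpose a b) S = Suc (num_orbits p S)
      \<or> Suc (num_orbits (p \<circ> Transposition.transpose a b) S) = num_orbits p S"
    using num_orbits_merge[OF swap.hyps(4) assms(2)] num_orbits_split[OF swap.hyps(4) assms(2)] swap(1-3)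
    by blast
  ultimately show ?case
    unfolding swap.IH by (metis add_Suc_right minus_minus mult_minus1 power_Suc)
qed

lemma num_orbits_inv:
  assumes "permutation p"
  shows "num_orbits (inv p) S = num_orbits p S"
  using orbit_inv_eq[OF assms] by (simp add: num_orbits_def)

text \<open>Inversion keeps the orbits and turns composition on the left into composition on the
  right.\<close>

lemma num_orbits_transpose_left:
  assumes p: "p permutes S" "finite S" and ab: "a \<in> S" "b \<in> S"
  shows "\<bar>int (num_orbits (Transposition.transpose a b \<circ> p) S) - int (num_orbits p S)\<bar> \<le> 1"
proof -
  have pp: "permutation p"
    using p by (rule permutes_permutation)
  have "inv (Transposition.transpose a b \<circ> p) = inv p \<circ> Transposition.transpose a b"
    using pp by (simp add: permutation_inverse_compose permutation_swap_id inv_swap_id)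
  then show ?thesis
    using num_orbits_transpose_cases(1)[OF permutes_inv[OF p(1)] p(2) ab]
      num_orbits_inv[of "Transposition.transpose a b \<circ> p" S] num_orbits_inv[OF pp, of S] pp
    by (simp add: permutation_compose permutation_swap_id)
qed

section \<open>Restriction to an invariant set and transport along a map\<close>

lemma perm_restrict_permutes:
  assumes "finite H" "inj_on p H" "p ` H \<subseteq> H"
  shows "perm_restrict p H permutes H"
proof -
  have "bij_betw p H H"
    using assms by (simp add: bij_betw_def endo_inj_surj)
  then have "bij_betw (perm_restrict p H) H H"
    by (rule bij_betw_cong[THEN iffD1, rotated]) (simp add: perm_restrict_simps)
  then show ?thesis
    by (rule bij_imp_permutes) (simp add: perm_restrict_simps)
qed

lemma map_permutation_off: "y \<notin> f ` A \<Longrightarrow> map_permutation A f p y = y"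
  by (simp add: map_permutation_def)

lemma num_orbits_perm_restrict:
  assumes "p ` H \<subseteq> H"
  shows "num_orbits (perm_restrict p H) H = num_orbits p H"
proof -
  have "orbit (perm_restrict p H) x = orbit p x" if "x \<in> H" for x
    by (rule orbit_cong0[of _ H]) (use that assms in \<open>auto simp: perm_restrict_simps\<close>)
  then show ?thesis
    unfolding num_orbits_def by (metis image_cong)
qed

section \<open>Permutations reversed by an involution\<close>

text \<open>An abstraction of face tracing: \<open>p\<close> makes one step of a facial walk and
  \<open>R\<close> reverses the direction. By \<open>p_R_p\<close>, \<open>R\<close> conjugates
  \<open>p\<close> to its inverse; the last two assumptions keep a walk from being its own
  reverse.\<close>

locale reversible_permutation =
  fixes p R :: "'a \<Rightarrow> 'a" and X :: "'a set"
  assumes finite_X: "finite X"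
    and p_permutes: "p permutes X"
    and R_X: "x \<in> X \<Longrightarrow> R x \<in> X"
    and R_R: "x \<in> X \<Longrightarrow> R (R x) = x"
    and p_R_p: "x \<in> X \<Longrightarrow> p (R (p x)) = R x"
    and R_neq: "x \<in> X \<Longrightarrow> R x \<noteq> x"
    and p_neq_R: "x \<in> X \<Longrightarrow> p x \<noteq> R x"
begin

lemma perm: "permutation p"
  using p_permutes finite_X by (rule permutes_permutation)

lemma p_X: "x \<in> X \<Longrightarrow> p x \<in> X"
  using p_permutes by (simp add: permutes_in_image)

lemma orbit_X: "x \<in> X \<Longrightarrow> orbit p x \<subseteq> X"
  using p_permutes by (rule permutes_orbit_subset)

lemma inj_on_R: "inj_on R X"
  using R_R by (rule inj_on_inverseI)

lemma orbit_R:
  assumes x: "x \<in> X"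
  shows "orbit p (R x) = R ` orbit p x"
proof -
  have "R ` orbit p x = orbit (inv p) (R x)"
  proof (rule orbit_inverse)
    show "x \<in> orbit p x"
      using perm by (rule permutation_self_in_orbit)
    fix y assume "y \<in> orbit p x"
    then have "y \<in> X"
      using orbit_X[OF x] by blast
    then show "inv p (R y) = R (p y)"
      using p_R_p[of y] permutes_inverses(2)[OF p_permutes, of "R (p y)"] by simp
  qed
  then show ?thesis
    using orbit_inv_eq[OF perm] by simp
qed

text \<open>A walk from \<open>x\<close> to \<open>R x\<close> can be shortened by one step at both
  ends, which gives a walk from \<open>p x\<close> to \<open>R (p x)\<close>. The descent ends at
  length 0 or 1, excluded by \<open>R_neq\<close> and \<open>p_neq_R\<close>.\<close>

lemma funpow_neq_R: "x \<in> X \<Longrightarrow> (p ^^ k) x \<noteq> R x"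
proof (induction k arbitrary: x rule: induct_nat_012)
  case 0
  then show ?case
    using R_neq by (metis funpow_0)
next
  case 1
  then show ?case
    using p_neq_R by simp
next
  case (ge2 k)
  show ?case
  proof
    assume "(p ^^ Suc (Suc k)) x = R x"
    then have "p ((p ^^ k) (p x)) = p (R (p x))"
      using p_R_p[OF ge2.prems] by (simp add: funpow_swap1)
    then have "(p ^^ k) (p x) = R (p x)"
      using permutes_inj[OF p_permutes] by (simp add: inj_eq)
    then show False
      using ge2.IH(1) p_X[OF ge2.prems] by blast
  qed
qed

lemma orbit_R_neq: "x \<in> X \<Longrightarrow> orbit p (R x) \<noteq> orbit p x"
  using permutation_self_in_orbit[OF perm, of "R x"] funpow_neq_R[of x]
  unfolding orbit_altdef[of p x] by force

text \<open>One of the two directions is chosen for every pair of mutually reverse orbits, and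
  \<open>H\<close> consists of the chosen orbits.\<close>

lemma ex_half:
  obtains H where "H \<subseteq> X" "X - H = R ` H" "\<And>x. x \<in> H \<Longrightarrow> orbit p x \<subseteq> H"
proof
  \<comment> \<open>The condition on \<open>Q\<close> is symmetric in \<open>x\<close> and
    \<open>R x\<close>, so both states receive the same choice.\<close>
  define c where "c x = (SOME Q. Q = orbit p x \<or> Q = orbit p (R x))" for x
  define H where "H = {x \<in> X. c x = orbit p x}"
  have c: "c x = orbit p x \<or> c x = orbit p (R x)" for x
    unfolding c_def by (rule someI_ex) auto
  have c_R: "c (R x) = c x" if "x \<in> X" for x
    unfolding c_def using R_R[OF that] by (simp add: disj_commute)
  show "H \<subseteq> X"
    by (auto simp: H_def)
  have iff: "R x \<in> H \<longleftrightarrow> x \<notin> H" if "x \<in> X" for x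
    using c[of x] c_R[OF that] R_X[OF that] orbit_R_neq[OF that] that by (auto simp: H_def)
  show "X - H = R ` H"
  proof
    show "X - H \<subseteq> R ` H"
    proof
      fix x assume "x \<in> X - H"
      then show "x \<in> R ` H"
        using iff[of x] R_R[of x] by (intro image_eqI[where x = "R x"]) auto
    qed
    show "R ` H \<subseteq> X - H"
      using iff R_X R_R by (auto simp: H_def)
  qed
  fix x assume x: "x \<in> H"
  show "orbit p x \<subseteq> H"
  proof
    fix y assume y: "y \<in> orbit p x"
    have "x \<in> X"
      using x by (simp add: H_def)
    then have "y \<in> X"
      using y orbit_X by blast
    have eq: "orbit p y = orbit p x"
      using perm y by (rule permutation_orbit_eq)
    then have "orbit p (R y) = orbit p (R x)"
      using orbit_R \<open>x \<in> X\<close> \<open>y \<in> X\<close> by simp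
    then have "c y = c x"
      by (simp add: c_def eq)
    then show "y \<in> H"
      using x eq \<open>y \<in> X\<close> by (simp add: H_def)
  qed
qed

text \<open>Each pair of reverse orbits has exactly one member inside \<open>H\<close>. As
  \<open>H\<close> only has to be closed under \<open>p\<close>, a half chosen for one permutation
  can serve for another one with the same \<open>R\<close>.\<close>

lemma card_orbit_pairs:
  assumes H: "H \<subseteq> X" "X - H = R ` H" "\<And>x. x \<in> H \<Longrightarrow> p x \<in> H"
  shows "card ((\<lambda>x. orbit p x \<union> orbit p (R x)) ` X) = num_orbits p H"
    and "num_orbits p X = 2 * num_orbits p H"
proof -
  have sub: "orbit p x \<subseteq> H" if "x \<in> H" for x
    using that H(3) by (rule orbit_subset_closed)
  have X: "X = H \<union> R ` H" and disj: "H \<inter> R ` H = {}"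
    using H(1,2) by auto
  have RH: "R ` H \<subseteq> X"
    using H(2) by auto
  let ?F = "\<lambda>x. orbit p x \<union> orbit p (R x)"
  have F_R: "?F (R x) = ?F x" if "x \<in> X" for x
    using R_R[OF that] by auto
  have "?F ` X = ?F ` H \<union> ?F ` (R ` H)"
    unfolding X by (rule image_Un)
  also have "?F ` (R ` H) = ?F ` H"
    using F_R H(1) by (auto simp: image_iff)
  finally have "?F ` X = ?F ` H"
    by simp
  also have "\<dots> = (\<lambda>Q. Q \<union> R ` Q) ` (orbit p ` H)"
    unfolding image_image using orbit_R H(1) by (intro image_cong) auto
  finally have F: "?F ` X = (\<lambda>Q. Q \<union> R ` Q) ` (orbit p ` H)" .
  \<comment> \<open>An orbit inside \<open>H\<close> is recovered from its union with its reverse by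
    intersecting with \<open>H\<close>.\<close>
  have "inj_on (\<lambda>Q. Q \<union> R ` Q) (orbit p ` H)"
  proof (rule inj_on_inverseI)
    fix Q assume "Q \<in> orbit p ` H"
    then have "Q \<subseteq> H"
      using sub by auto
    then show "(Q \<union> R ` Q) \<inter> H = Q"
      using disj by auto
  qed
  then show "card (?F ` X) = num_orbits p H"
    unfolding F num_orbits_def by (rule card_image)
  have O: "orbit p ` X = orbit p ` H \<union> (image R) ` (orbit p ` H)"
  proof -
    have "orbit p ` X = orbit p ` H \<union> orbit p ` (R ` H)"
      unfolding X by (rule image_Un)
    also have "orbit p ` (R ` H) = (image R) ` (orbit p ` H)"
      unfolding image_image using orbit_R H(1) by (intro image_cong) auto
    finally show ?thesis .
  qed
  have "card ((image R) ` (orbit p ` H)) = card (orbit p ` H)"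
  proof (rule card_image, rule inj_onI)
    fix P Q assume "P \<in> orbit p ` H" "Q \<in> orbit p ` H" "R ` P = R ` Q"
    moreover from this have "P \<subseteq> X" "Q \<subseteq> X"
      using sub H(1) by blast+
    ultimately show "P = Q"
      using inj_on_image_eq_iff[OF inj_on_R] by blast
  qed
  moreover have "orbit p ` H \<inter> (image R) ` (orbit p ` H) = {}"
  proof -
    have False if "x \<in> H" "y \<in> H" "orbit p x = R ` orbit p y" for x y
    proof -
      have "orbit p x \<subseteq> H" "orbit p x \<subseteq> R ` H"
        using sub[OF that(1)] sub[OF that(2)] that(3) by auto
      then show False
        using disj orbit_nonempty[of p x] by blast
    qed
    then show ?thesis
      by auto
  qed
  moreover have "finite H"
    using H(1) finite_X by (rule finite_subset)
  ultimately show "num_orbits p X = 2 * num_orbits p H"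
    unfolding num_orbits_def O by (subst card_Un_disjoint) auto
qed

lemma num_orbits_eq_card_orbit_pairs:
  "num_orbits p X = 2 * card ((\<lambda>x. orbit p x \<union> orbit p (R x)) ` X)"
proof -
  obtain H where "H \<subseteq> X" "X - H = R ` H" "\<And>x. x \<in> H \<Longrightarrow> orbit p x \<subseteq> H"
    using ex_half by metis
  then show ?thesis
    using card_orbit_pairs[of H] orbit.base[of p] by (metis subsetD)
qed

end

section \<open>Face tracing as a permutation\<close>

context signed_graph
begin

text \<open>Outside \<open>states\<close> the tracing is replaced by the identity, as
  \<open>permutes\<close> demands. The orbits of the states stay the same.\<close>

definition face_perm :: "('d \<Rightarrow> 'd) \<Rightarrow> 'd \<times> int \<Rightarrow> 'd \<times> int" where
  "face_perm \<pi> = perm_restrict (face_step \<pi>) states"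

text \<open>For a dart \<open>d\<close> of the graph, this state runs along \<open>d\<close>
  backwards and arrives at the tail of \<open>d\<close> with positive orientation, so that its
  successor is \<open>(\<pi> d, 1)\<close>.\<close>

definition corner :: "'d \<Rightarrow> 'd \<times> int" where
  "corner d = (arev d, \<sigma> d)"

lemma sign_square: "a \<in> arcs G \<Longrightarrow> \<sigma> a * \<sigma> a = 1"
  using sign_values[of a] by auto

lemma finite_states: "finite states"
  by (simp add: states_def)

lemma face_step_states:
  assumes "\<pi> permutes arcs G" "x \<in> states"
  shows "face_step \<pi> x \<in> states"
proof -
  obtain a s where x: "x = (a, s)" "a \<in> arcs G" "s = 1 \<or> s = -1"
    using assms(2) by (auto simp: states_def)
  then show ?thesis
    using sign_values[of a] permutes_in_image[OF assms(1)] permutes_in_image[OF permutes_inv[OF assms(1)]]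
    by (auto simp: states_def face_step_def Let_def)
qed

text \<open>The sign of the result tells whether \<open>\<pi>\<close> or its inverse was applied, so
  the dart can be recovered, and then the old sign as well.\<close>

lemma inj_on_face_step:
  assumes \<pi>: "\<pi> permutes arcs G"
  shows "inj_on (face_step \<pi>) states"
proof (rule inj_onI, clarify)
  fix a s b t
  assume "(a, s) \<in> states" "(b, t) \<in> states" and eq: "face_step \<pi> (a, s) = face_step \<pi> (b, t)"
  then have ab: "a \<in> arcs G" "b \<in> arcs G"
    by (auto simp: states_def)
  have inj: "inj \<pi>" "inj (inv \<pi>)"
    using permutes_inj[OF \<pi>] permutes_inj[OF permutes_inv[OF \<pi>]] by auto
  have st: "s * \<sigma> a = t * \<sigma> b"
    using eq by (auto simp: face_step_def Let_def)
  then have "arev a = arev b"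
    using eq inj by (auto simp: face_step_def Let_def inj_eq split: if_splits)
  then have "a = b"
    by (simp add: arev_eq_iff)
  then show "a = b \<and> s = t"
    using st sign_values[OF ab(1)] by auto
qed

lemma face_perm_permutes: "\<pi> permutes arcs G \<Longrightarrow> face_perm \<pi> permutes states"
  unfolding face_perm_def
  using finite_states inj_on_face_step face_step_states by (intro perm_restrict_permutes) auto

text \<open>The reverse of the next state arrives with the opposite orientation, so the inverse
  rotation is applied there and undoes the step. A state and its reverse have different darts; the
  successor of a state and its reverse have different signs.\<close>

lemma reversible_face_perm:
  assumes \<pi>: "\<pi> permutes arcs G"
  shows "reversible_permutation (face_perm \<pi>) reverse_state states"
proof
  show "finite states"
    by (rule finite_states)
  show "face_perm \<pi> permutes states"
    using \<pi> by (rule face_perm_permutes)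
  fix x assume x: "x \<in> states"
  obtain a s where [simp]: "x = (a, s)"
    by (cases x)
  have a: "a \<in> arcs G" and s: "s = 1 \<or> s = -1"
    using x by (auto simp: states_def)
  show "reverse_state x \<in> states"
    using a s sign_values[OF a] by (auto simp: states_def reverse_state_def)
  show "reverse_state (reverse_state x) = x"
    using a s sign_values[OF a] by (auto simp: reverse_state_def sign_arev)
  show "reverse_state x \<noteq> x"
    using arev_neq[OF a] by (simp add: reverse_state_def)
  show "face_perm \<pi> x \<noteq> reverse_state x"
    using x a s sign_values[OF a]
    by (auto simp: face_perm_def perm_restrict_simps face_step_def reverse_state_def Let_def)
  show "face_perm \<pi> (reverse_state (face_perm \<pi> x)) = reverse_state x"
  proof -
    define t where "t = s * \<sigma> a"
    define b where "b = (if t = 1 then \<pi> else inv \<pi>) (arev a)"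
    have t: "t = 1 \<or> t = -1"
      using s sign_values[OF a] by (auto simp: t_def)
    have b: "b \<in> arcs G"
      using a permutes_in_image[OF \<pi>] permutes_in_image[OF permutes_inv[OF \<pi>]]
      by (simp add: b_def)
    have 1: "face_perm \<pi> x = (b, t)"
      using x by (simp add: face_perm_def perm_restrict_simps face_step_def Let_def t_def b_def)
    have 2: "reverse_state (b, t) = (arev b, - (t * \<sigma> b))"
      by (simp add: reverse_state_def)
    have "(arev b, - (t * \<sigma> b)) \<in> states"
      using b t sign_values[OF b] by (auto simp: states_def)
    then have "face_perm \<pi> (arev b, - (t * \<sigma> b))
        = ((if - t = 1 then \<pi> else inv \<pi>) b, - t)"
      using b t sign_values[OF b]
      by (auto simp: face_perm_def perm_restrict_simps face_step_def Let_def sign_arev)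
    also have "\<dots> = (arev a, - t)"
      using t permutes_inverses[OF \<pi>] by (auto simp: b_def)
    finally have "face_perm \<pi> (arev b, - (t * \<sigma> b)) = (arev a, - t)" .
    moreover have "reverse_state x = (arev a, - t)"
      by (simp add: reverse_state_def t_def)
    ultimately show ?thesis
      by (simp only: 1 2)
  qed
qed

lemma face_of_eq:
  assumes \<pi>: "\<pi> permutes arcs G" and x: "x \<in> states"
  shows "face_of \<pi> x = orbit (face_perm \<pi>) x \<union> orbit (face_perm \<pi>) (reverse_state x)"
proof -
  interpret reversible_permutation "face_perm \<pi>" reverse_state states
    using \<pi> by (rule reversible_face_perm)
  have "orbit (face_step \<pi>) y = orbit (face_perm \<pi>) y" if "y \<in> states" for y
    using that face_step_states[OF \<pi>]
    by (intro orbit_cong0[of _ states]) (auto simp: face_perm_def perm_restrict_simps)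
  then show ?thesis
    using x R_X[OF x] by (simp add: face_of_def)
qed

lemma num_faces_eq:
  assumes "\<pi> permutes arcs G"
  shows "num_faces \<pi> = card ((\<lambda>x. orbit (face_perm \<pi>) x
    \<union> orbit (face_perm \<pi>) (reverse_state x)) ` states) + card {v \<in> verts G. out_arcs G v = {}}"
  unfolding num_faces_def using face_of_eq[OF assms] by simp

section \<open>Corners, and the effect of a change of the rotation on the faces\<close>

lemma corner_states: "d \<in> arcs G \<Longrightarrow> corner d \<in> states"
  using sign_values by (auto simp: corner_def states_def)

lemma inj_on_corner: "inj_on corner (arcs G)"
  by (auto simp: inj_on_def corner_def arev_eq_iff)

lemma reverse_state_corner: "d \<in> arcs G \<Longrightarrow> reverse_state (corner d) = (d, - 1)"
  using sign_square by (simp add: corner_def reverse_state_def sign_arev)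

text \<open>
  A change of the rotation acts on the states \<open>corner d\<close>, which pass the corner after \<open>d\<close> in the
  positive sense, and inversely on the states \<open>(d, - 1)\<close>, which pass it in the negative sense. The
  inverse action is moved to the left-hand side.
\<close>

lemma face_perm_comp:
  assumes \<pi>: "\<pi> permutes arcs G" and \<kappa>: "\<kappa> permutes arcs G"
  shows "map_permutation (arcs G) (\<lambda>d. (d, - 1)) \<kappa> \<circ> face_perm (\<pi> \<circ> \<kappa>)
    = face_perm \<pi> \<circ> map_permutation (arcs G) corner \<kappa>" (is "?V \<circ> _ = _ \<circ> ?D")
proof
  fix x
  have V: "?V (d, - 1) = (\<kappa> d, - 1)" if "d \<in> arcs G" for d
    using map_permutation_apply[of "\<lambda>d. (d, - 1 :: int)" "arcs G" d \<kappa>] that by (simp add: inj_on_def)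
  have V': "?V y = y" if "y \<notin> (\<lambda>d. (d, - 1)) ` arcs G" for y
    using that by (rule map_permutation_off)
  have D: "?D (corner d) = corner (\<kappa> d)" if "d \<in> arcs G" for d
    using map_permutation_apply[OF inj_on_corner that] .
  have D': "?D y = y" if "y \<notin> corner ` arcs G" for y
    using that by (rule map_permutation_off)
  have \<pi>\<kappa>: "inv (\<pi> \<circ> \<kappa>) = inv \<kappa> \<circ> inv \<pi>"
    using \<pi> \<kappa> by (simp add: o_inv_distrib permutes_bij)
  show "(?V \<circ> face_perm (\<pi> \<circ> \<kappa>)) x = (face_perm \<pi> \<circ> ?D) x"
  proof (cases "x \<in> states")
    case False
    then have "x \<notin> corner ` arcs G"
      using corner_states by auto
    moreover have "x \<notin> (\<lambda>d. (d, - 1)) ` arcs G"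
      using False by (auto simp: states_def)
    ultimately show ?thesis
      using False by (simp add: face_perm_def perm_restrict_simps V' D')
  next
    case True
    then obtain a s where x: "x = (a, s)" "a \<in> arcs G" "s = 1 \<or> s = - 1"
      by (auto simp: states_def)
    define b where "b = arev a"
    have b: "b \<in> arcs G" "a = arev b" "\<sigma> a = \<sigma> b"
      using x by (auto simp: b_def sign_arev)
    show ?thesis
    \<comment> \<open>If equality holds, \<open>x\<close> is a corner state and its successor has
      sign 1, so only \<open>?D\<close> can act. Otherwise the successor has sign -1 and only
      \<open>?V\<close> can act.\<close>
    proof (cases "s = \<sigma> a")
      case True
      have "x = corner b"
        using True b by (simp add: x corner_def)
      have \<kappa>b: "\<kappa> b \<in> arcs G"
        using b permutes_in_image[OF \<kappa>] by simp
      have step: "face_perm \<rho> (corner d) = (\<rho> d, 1)" if "d \<in> arcs G" for \<rho> d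
        using corner_states[OF that] sign_square[OF that] that
        by (simp add: face_perm_def perm_restrict_simps face_step_def corner_def Let_def sign_arev)
      have "(\<pi> (\<kappa> b), 1 :: int) \<notin> (\<lambda>d. (d, - 1)) ` arcs G"
        by auto
      then show ?thesis
        using b \<kappa>b by (simp add: \<open>x = corner b\<close> step D V')
    next
      case False
      then have "x \<notin> corner ` arcs G"
        using x by (auto simp: corner_def sign_arev)
      have s: "s * \<sigma> a = - 1"
        using False x sign_values[OF x(2)] by auto
      have step: "face_perm \<rho> x = (inv \<rho> b, - 1)" for \<rho>
        using \<open>x \<in> states\<close> s by (simp add: face_perm_def perm_restrict_simps face_step_def x Let_def b_def)
      have "inv \<kappa> (inv \<pi> b) \<in> arcs G"
        using b permutes_in_image[OF permutes_inv[OF \<kappa>]] permutes_in_image[OF permutes_inv[OF \<pi>]] by simp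
      then show ?thesis
        using permutes_inverses(1)[OF \<kappa>]
        by (simp add: step \<pi>\<kappa> D' V \<open>x \<notin> corner ` arcs G\<close>)
    qed
  qed
qed

text \<open>By \<open>face_perm_comp\<close>, two transpositions of corner states and two of states
  with sign -1 lead from one face permutation to the other. Each changes the number of orbits by at
  most 1, and a face accounts for two orbits. A gain of two faces forces all four to split, in
  particular the first one, which exchanges the corners of \<open>d\<close> and
  \<open>x\<close>.\<close>

lemma num_faces_comp_transpose:
  assumes \<pi>: "\<pi> permutes arcs G" and arcs: "d \<in> arcs G" "x \<in> arcs G" "l \<in> arcs G"
  defines "\<kappa> \<equiv> Transposition.transpose d x \<circ> Transposition.transpose x l"
  shows "\<bar>int (num_faces (\<pi> \<circ> \<kappa>)) - int (num_faces \<pi>)\<bar> \<le> 2"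
    and "num_faces (\<pi> \<circ> \<kappa>) = num_faces \<pi> + 2 \<Longrightarrow> corner x \<in> orbit (face_perm \<pi>) (corner d)"
proof -
  have \<kappa>: "\<kappa> permutes arcs G"
    unfolding \<kappa>_def using arcs by (intro permutes_compose permutes_swap_id)
  have \<pi>\<kappa>: "\<pi> \<circ> \<kappa> permutes arcs G"
    using \<kappa> \<pi> by (rule permutes_compose)
  interpret P: reversible_permutation "face_perm \<pi>" reverse_state states
    using \<pi> by (rule reversible_face_perm)
  interpret Q: reversible_permutation "face_perm (\<pi> \<circ> \<kappa>)" reverse_state states
    using \<pi>\<kappa> by (rule reversible_face_perm)
  have map: "map_permutation (arcs G) f \<kappa>
      = Transposition.transpose (f d) (f x) \<circ> Transposition.transpose (f x) (f l)"
    if "inj_on f (arcs G)" for f :: "'d \<Rightarrow> 'd \<times> int"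
    unfolding \<kappa>_def using that arcs
    by (simp add: map_permutation_compose' map_permutation_transpose permutes_swap_id)
  \<comment> \<open>\<open>p1\<close> and \<open>p2\<close> start from
    \<open>face_perm \<pi>\<close>, and \<open>p3\<close> starts from the other end. The fact
    \<open>p23\<close> joins the two chains, so that neighbours always differ by one
    transposition.\<close>
  define p1 where "p1 = face_perm \<pi> \<circ> Transposition.transpose (corner d) (corner x)"
  define p2 where "p2 = p1 \<circ> Transposition.transpose (corner x) (corner l)"
  define p3 where "p3 = Transposition.transpose (x, - 1) (l, - 1) \<circ> face_perm (\<pi> \<circ> \<kappa>)"
  have states: "(e, - 1) \<in> states" if "e \<in> arcs G" for e
    using that by (simp add: states_def)
  have p1: "p1 permutes states"
    unfolding p1_def using corner_states arcs
    by (intro permutes_compose permutes_swap_id P.p_permutes) auto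
  have p3: "p3 permutes states"
    unfolding p3_def using states arcs
    by (intro permutes_compose permutes_swap_id Q.p_permutes) auto
  have inj: "inj_on (\<lambda>d. (d, - 1 :: int)) (arcs G)"
    by (simp add: inj_on_def)
  have p23: "Transposition.transpose (d, - 1) (x, - 1) \<circ> p3 = p2"
    using face_perm_comp[OF \<pi> \<kappa>] unfolding map[OF inj] map[OF inj_on_corner] p2_def p1_def p3_def
    by (simp only: o_assoc)
  note c = num_orbits_transpose_cases[OF _ finite_states corner_states corner_states]
    and n = num_orbits_transpose_left[OF _ finite_states states states]
  have steps: "\<bar>int (num_orbits p1 states) - int (num_orbits (face_perm \<pi>) states)\<bar> \<le> 1"
    "\<bar>int (num_orbits p2 states) - int (num_orbits p1 states)\<bar> \<le> 1"
    "\<bar>int (num_orbits p2 states) - int (num_orbits p3 states)\<bar> \<le> 1"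
    "\<bar>int (num_orbits p3 states) - int (num_orbits (face_perm (\<pi> \<circ> \<kappa>)) states)\<bar> \<le> 1"
    using c(1)[OF P.p_permutes arcs(1,2)] c(1)[OF p1 arcs(2,3)]
      n[OF p3 arcs(1,2), unfolded p23] n[OF Q.p_permutes arcs(2,3)]
    by (auto simp only: p1_def p2_def p3_def)
  have faces: "int (num_orbits (face_perm (\<pi> \<circ> \<kappa>)) states) - int (num_orbits (face_perm \<pi>) states)
      = 2 * (int (num_faces (\<pi> \<circ> \<kappa>)) - int (num_faces \<pi>))"
    using P.num_orbits_eq_card_orbit_pairs Q.num_orbits_eq_card_orbit_pairs
      num_faces_eq[OF \<pi>] num_faces_eq[OF \<pi>\<kappa>] by simp
  have total: "\<bar>int (num_orbits (face_perm (\<pi> \<circ> \<kappa>)) states) - int (num_orbits (face_perm \<pi>) states)\<bar> \<le> 4"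
    using steps[THEN abs_le_D1] steps[THEN abs_le_D2] by (intro abs_leI) linarith+
  show "\<bar>int (num_faces (\<pi> \<circ> \<kappa>)) - int (num_faces \<pi>)\<bar> \<le> 2"
    using total faces by simp
  show "corner x \<in> orbit (face_perm \<pi>) (corner d)" if "num_faces (\<pi> \<circ> \<kappa>) = num_faces \<pi> + 2"
  proof (rule c(2)[OF P.p_permutes arcs(1,2)])
    show "int (num_orbits (face_perm \<pi> \<circ> Transposition.transpose (corner d) (corner x)) states)
        = int (num_orbits (face_perm \<pi>) states) + 1"
      using steps[THEN abs_le_D1] steps[THEN abs_le_D2] faces that
      unfolding p1_def[symmetric] by simp
  qed
qed

text \<open>
  If \<open>\<kappa>\<close> moves every corner within its directed facial walk, then it regroups the pieces of these
  walks without reversing any of them. So the new faces are the orbits of a permutation of the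
  coherently directed half \<open>H\<close> of the states, which differs from the old one by an even permutation.
\<close>

lemma even_num_faces_comp:
  assumes \<pi>: "\<pi> permutes arcs G" and \<kappa>: "\<kappa> permutes arcs G" and sign: "sign \<kappa> = 1"
    and same: "\<And>d. d \<in> arcs G \<Longrightarrow> corner (\<kappa> d) \<in> orbit (face_perm \<pi>) (corner d)"
  shows "even (num_faces (\<pi> \<circ> \<kappa>)) \<longleftrightarrow> even (num_faces \<pi>)"
proof -
  have \<pi>\<kappa>: "\<pi> \<circ> \<kappa> permutes arcs G"
    using \<kappa> \<pi> by (rule permutes_compose)
  let ?p = "face_perm \<pi>" and ?q = "face_perm (\<pi> \<circ> \<kappa>)"
  let ?V = "map_permutation (arcs G) (\<lambda>d. (d, - 1 :: int)) \<kappa>" and ?D = "map_permutation (arcs G) corner \<kappa>"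
  interpret P: reversible_permutation ?p reverse_state states
    using \<pi> by (rule reversible_face_perm)
  interpret Q: reversible_permutation ?q reverse_state states
    using \<pi>\<kappa> by (rule reversible_face_perm)
  obtain H where H: "H \<subseteq> states" "states - H = reverse_state ` H" "\<And>x. x \<in> H \<Longrightarrow> orbit ?p x \<subseteq> H"
    using P.ex_half by metis
  have fin: "finite H"
    using H(1) finite_states by (rule finite_subset)
  have \<kappa>_arcs: "\<kappa> d \<in> arcs G \<longleftrightarrow> d \<in> arcs G" for d
    using permutes_in_image[OF \<kappa>] .
  have inj: "inj_on (\<lambda>d. (d, - 1 :: int)) (arcs G)"
    by (simp add: inj_on_def)
  have corner_H: "corner (\<kappa> d) \<in> H \<longleftrightarrow> corner d \<in> H" if "d \<in> arcs G" for d
    using same[OF that] H(3) permutation_orbit_eq[OF P.perm same[OF that]]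
      permutation_self_in_orbit[OF P.perm] by blast
  \<comment> \<open>\<open>(d, - 1)\<close> is the reverse of \<open>corner d\<close>, and
    \<open>H\<close> contains exactly one of two reverse states.\<close>
  have neg_H: "(d, - 1) \<in> H \<longleftrightarrow> corner d \<notin> H" if "d \<in> arcs G" for d
  proof -
    have "reverse_state x \<in> H \<longleftrightarrow> x \<notin> H" if "x \<in> states" for x
    proof
      show "x \<notin> H" if "reverse_state x \<in> H"
        using imageI[OF that, of reverse_state] H(2) P.R_R[OF \<open>x \<in> states\<close>] by auto
      assume "x \<notin> H"
      then have "x \<in> states - H"
        using that by simp
      then have "x \<in> reverse_state ` H"
        unfolding H(2) .
      then obtain y where "x = reverse_state y" "y \<in> H"
        by (rule imageE)
      then show "reverse_state x \<in> H"
        using P.R_R[of y] H(1) by auto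
    qed
    then show ?thesis
      using reverse_state_corner[OF that] corner_states[OF that] by metis
  qed
  have D: "?D (corner d) = corner (\<kappa> d)" if "d \<in> arcs G" for d
    using map_permutation_apply[OF inj_on_corner that] .
  have D': "?D y = y" if "y \<notin> corner ` arcs G" for y
    using that by (rule map_permutation_off)
  have V: "?V (d, - 1) = (\<kappa> d, - 1)" if "d \<in> arcs G" for d
    using map_permutation_apply[OF inj that] .
  have V': "?V y = y" if "y \<notin> (\<lambda>d. (d, - 1)) ` arcs G" for y
    using that by (rule map_permutation_off)
  have D_H: "?D y \<in> H" if "y \<in> H" for y
    using that D D' corner_H by (cases "y \<in> corner ` arcs G") auto
  have V_H: "?V y \<in> H \<longleftrightarrow> y \<in> H" for y
    using V V' corner_H neg_H \<kappa>_arcs by (cases "y \<in> (\<lambda>d. (d, - 1)) ` arcs G") auto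
  have p_H: "?p y \<in> H" if "y \<in> H" for y
    using that H(3) orbit.base[of ?p y] by blast
  have comp: "?V (?q y) = ?p (?D y)" for y
    using fun_cong[OF face_perm_comp[OF \<pi> \<kappa>], of y] by simp
  have q_H: "?q y \<in> H" if "y \<in> H" for y
    using that comp[of y] p_H D_H V_H by metis
  \<comment> \<open>The walks in \<open>H\<close> pass the corners of \<open>?K\<close> in the
    positive sense and those of \<open>?L\<close> in the negative sense; \<open>\<kappa>\<close>
    preserves both sets.\<close>
  let ?K = "{d \<in> arcs G. corner d \<in> H}"
  let ?L = "arcs G - ?K"
  have \<kappa>K: "perm_restrict \<kappa> ?K permutes ?K" and \<kappa>L: "perm_restrict \<kappa> ?L permutes ?L"
    using corner_H \<kappa>_arcs
    by (auto intro!: perm_restrict_permutes inj_on_subset[OF permutes_inj[OF \<kappa>]])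
  have \<kappa>KL: "perm_restrict \<kappa> ?K permutes arcs G" "perm_restrict \<kappa> ?L permutes arcs G"
    by (rule permutes_subset[OF \<kappa>K], blast) (rule permutes_subset[OF \<kappa>L], blast)
  have "perm_restrict \<kappa> ?K \<circ> perm_restrict \<kappa> ?L = perm_restrict \<kappa> (?K \<union> ?L)"
    using \<kappa>K \<kappa>L by (rule perm_restrict_union) blast
  also have "?K \<union> ?L = arcs G"
    by blast
  finally have "perm_restrict \<kappa> ?K \<circ> perm_restrict \<kappa> ?L = \<kappa>"
    by (simp only: perm_restrict_id[OF \<kappa>])
  then have sign_KL: "sign (perm_restrict \<kappa> ?K) * sign (perm_restrict \<kappa> ?L) = 1"
    using sign sign_compose[OF permutes_permutation[OF \<kappa>KL(1) finite_arcs] permutes_permutation[OF \<kappa>KL(2) finite_arcs]] by simp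
  \<comment> \<open>Inside \<open>H\<close>, \<open>?D\<close> moves only corners of
    \<open>?K\<close> and \<open>?V\<close> only those of \<open>?L\<close>. Together their signs
    give the sign of \<open>\<kappa>\<close>.\<close>
  have DH: "perm_restrict ?D H = map_permutation (arcs G) corner (perm_restrict \<kappa> ?K)"
  proof
    fix y
    show "perm_restrict ?D H y = map_permutation (arcs G) corner (perm_restrict \<kappa> ?K) y"
    proof (cases "y \<in> corner ` arcs G")
      case True
      then obtain d where "d \<in> arcs G" "y = corner d"
        by blast
      then show ?thesis
        using D map_permutation_apply[OF inj_on_corner, of d "perm_restrict \<kappa> ?K"]
        by (auto simp: perm_restrict_def)
    next
      case False
      then show ?thesis
        by (simp only: perm_restrict_def D'[OF False] map_permutation_off[OF False] if_cancel)
    qed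
  qed
  have VH: "perm_restrict ?V H = map_permutation (arcs G) (\<lambda>d. (d, - 1)) (perm_restrict \<kappa> ?L)"
  proof
    fix y
    show "perm_restrict ?V H y = map_permutation (arcs G) (\<lambda>d. (d, - 1)) (perm_restrict \<kappa> ?L) y"
    proof (cases "y \<in> (\<lambda>d. (d, - 1)) ` arcs G")
      case True
      then obtain d where "d \<in> arcs G" "y = (d, - 1)"
        by blast
      then show ?thesis
        using V neg_H map_permutation_apply[OF inj, of d "perm_restrict \<kappa> ?L"]
        by (auto simp: perm_restrict_def)
    next
      case False
      then show ?thesis
        by (simp only: perm_restrict_def V'[OF False] map_permutation_off[OF False] if_cancel)
    qed
  qed
  have "sign (perm_restrict ?D H) = sign (perm_restrict \<kappa> ?K)"
    "sign (perm_restrict ?V H) = sign (perm_restrict \<kappa> ?L)"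
    unfolding DH VH using inj_on_corner inj \<kappa>KL by (simp_all only: sign_map_permutation finite_arcs)
  then have sign_VD: "sign (perm_restrict ?V H) * sign (perm_restrict ?D H) = 1"
    using sign_KL by (simp add: mult.commute)
  have inj_H: "inj_on f H" if "f permutes A" for f :: "'d \<times> int \<Rightarrow> 'd \<times> int" and A
    using permutes_inj[OF that] by (rule inj_on_subset) simp
  have bij: "bij_betw f (arcs G) (f ` arcs G)" if "inj_on f (arcs G)" for f :: "'d \<Rightarrow> 'd \<times> int"
    using that by (simp add: bij_betw_def)
  have perm_H: "perm_restrict ?D H permutes H" "perm_restrict ?V H permutes H"
    "perm_restrict ?p H permutes H" "perm_restrict ?q H permutes H"
    using D_H V_H p_H q_H fin inj_H[OF map_permutation_permutes[OF bij[OF inj_on_corner] \<kappa>]]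
      inj_H[OF map_permutation_permutes[OF bij[OF inj] \<kappa>]] inj_H[OF P.p_permutes] inj_H[OF Q.p_permutes]
    by (auto intro!: perm_restrict_permutes)
  note perm_H' = perm_H[THEN permutes_permutation, OF fin]
  \<comment> \<open>Since the signs of the outer factors cancel, the old and the new face
    permutation have equal sign on \<open>H\<close>, hence numbers of orbits of equal parity
    there.\<close>
  have "perm_restrict ?V H \<circ> perm_restrict ?q H = perm_restrict ?p H \<circ> perm_restrict ?D H"
    using comp q_H D_H by (auto simp: fun_eq_iff perm_restrict_def)
  then have "sign (perm_restrict ?V H) * sign (perm_restrict ?q H)
      = sign (perm_restrict ?p H) * sign (perm_restrict ?D H)"
    using sign_compose[OF perm_H'(2,4)] sign_compose[OF perm_H'(3,1)] by simp
  then have "sign (perm_restrict ?q H) = sign (perm_restrict ?p H)"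
    using sign_VD by (simp add: sign_def split: if_splits)
  then have "even (num_orbits ?q H) \<longleftrightarrow> even (num_orbits ?p H)"
    using sign_eq_num_orbits[OF perm_H(3) fin] sign_eq_num_orbits[OF perm_H(4) fin]
      num_orbits_perm_restrict[of ?p H] num_orbits_perm_restrict[of ?q H] p_H q_H
    by (auto simp: minus_one_power_iff image_subset_iff split: if_splits)
  then show ?thesis
    unfolding num_faces_eq[OF \<pi>] num_faces_eq[OF \<pi>\<kappa>]
    using P.card_orbit_pairs(1)[OF H(1,2) p_H] Q.card_orbit_pairs(1)[OF H(1,2) q_H] by simp
qed

section \<open>Exchange between rotation systems\<close>

lemma rotation_permutes: "rotation_system \<pi> \<Longrightarrow> \<pi> permutes arcs G"
  by (simp add: rotation_system_def)

lemma orbit_rotation: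
  assumes "rotation_system \<pi>" "a \<in> arcs G"
  shows "orbit \<pi> a = out_arcs G (tail G a)"
proof (rule orbit_cyclic_eq3)
  have "a \<in> out_arcs G (tail G a)" "tail G a \<in> verts G"
    using assms(2) by auto
  then show "cyclic_on \<pi> (out_arcs G (tail G a))"
    using assms(1) unfolding rotation_system_def by blast
  show "a \<in> out_arcs G (tail G a)"
    by fact
qed

lemma rotation_systemI:
  assumes "\<pi> permutes arcs G" "\<And>a. a \<in> arcs G \<Longrightarrow> orbit \<pi> a = out_arcs G (tail G a)"
  shows "rotation_system \<pi>"
  unfolding rotation_system_def
proof (intro conjI ballI impI)
  fix v assume "out_arcs G v \<noteq> {}"
  then obtain a where "a \<in> out_arcs G v"
    by blast
  then have "a \<in> arcs G" "tail G a = v"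
    by auto
  then show "cyclic_on \<pi> (out_arcs G v)"
    using assms(2)[of a] by (intro cyclic_on_singleI[of a]) auto
qed fact

text \<open>The orbits of any rotation system on the darts are the sets of darts leaving a vertex,
  and the sign depends only on their number.\<close>

lemma sign_rotation:
  assumes "rotation_system \<rho>" "rotation_system \<xi>"
  shows "sign (inv \<rho> \<circ> \<xi>) = 1"
proof -
  have "num_orbits \<rho> (arcs G) = num_orbits \<xi> (arcs G)"
    unfolding num_orbits_def using orbit_rotation[OF assms(1)] orbit_rotation[OF assms(2)]
    by (metis (no_types, lifting) image_cong)
  then have "sign \<rho> = sign \<xi>"
    using assms[THEN rotation_permutes, THEN sign_eq_num_orbits] by simp
  then show ?thesis
    using assms[THEN rotation_permutes, THEN permutes_permutation]
    by (simp add: sign_compose sign_inverse permutation_inverse)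
qed

text \<open>
  The block of darts from \<open>\<xi> d\<close> to \<open>l\<close>, on which \<open>\<rho>\<close> already agrees with \<open>\<xi>\<close> except at its last
  dart, is moved to the place after \<open>d\<close>.
\<close>

lemma rotation_exchange:
  assumes \<rho>: "rotation_system \<rho>" and \<xi>: "rotation_system \<xi>" and d: "\<rho> d \<noteq> \<xi> d"
  defines "x \<equiv> (inv \<rho> \<circ> \<xi>) d"
  obtains l where "d \<in> arcs G" "x \<in> arcs G" "l \<in> arcs G"
    "rotation_system (\<rho> \<circ> (Transposition.transpose d x \<circ> Transposition.transpose x l))"
    "{a. (\<rho> \<circ> (Transposition.transpose d x \<circ> Transposition.transpose x l)) a \<noteq> \<xi> a} \<subset> {a. \<rho> a \<noteq> \<xi> a}"
proof -
  note \<rho>p = rotation_permutes[OF \<rho>] and \<xi>p = rotation_permutes[OF \<xi>]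
  have perm: "permutation \<rho>" "permutation \<xi>"
    using \<rho>p \<xi>p by (auto intro: permutes_permutation)
  have d_arc: "d \<in> arcs G"
    using d permutes_not_in[OF \<rho>p] permutes_not_in[OF \<xi>p] by metis
  have \<rho>x: "\<rho> x = \<xi> d"
    using permutes_inverses(1)[OF \<rho>p] by (simp add: x_def)
  have "\<xi> d \<in> orbit \<rho> d"
    using orbit.base[of \<xi> d] orbit_rotation[OF \<rho> d_arc] orbit_rotation[OF \<xi> d_arc] by simp
  then have orbit_x: "orbit \<rho> x = orbit \<rho> d"
    using permutation_orbit_step[OF perm(1), of x] permutation_orbit_eq[OF perm(1)] \<rho>x by metis
  have "orbit \<rho> d \<subseteq> arcs G"
    using \<rho>p d_arc by (rule permutes_orbit_subset)
  then have x_arc: "x \<in> arcs G"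
    using permutation_self_in_orbit[OF perm(1), of x] orbit_x by auto
  have dx: "d \<noteq> x"
    using \<rho>x d by auto
  have x: "\<rho> x \<noteq> \<xi> x"
    using \<rho>x dx permutes_inj[OF \<xi>p] by (auto dest: injD)
  \<comment> \<open>\<open>n\<close> marks the first disagreement after \<open>x\<close> along
    \<open>\<rho>\<close>. The index 0 is excluded because \<open>x\<close> itself is a
    disagreement; the return to \<open>x\<close> shows that \<open>n\<close> exists.\<close>
  define n where "n = (LEAST n. 0 < n \<and> \<rho> ((\<rho> ^^ n) x) \<noteq> \<xi> ((\<rho> ^^ n) x))"
  obtain m where m: "(\<rho> ^^ m) x = x" "0 < m"
    using permutation_self[OF perm(1)] by metis
  have "0 < n \<and> \<rho> ((\<rho> ^^ n) x) \<noteq> \<xi> ((\<rho> ^^ n) x)"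
    unfolding n_def by (rule LeastI[of _ m]) (simp add: m x)
  then have n: "0 < n" "\<rho> ((\<rho> ^^ n) x) \<noteq> \<xi> ((\<rho> ^^ n) x)"
    by auto
  have agree: "\<rho> ((\<rho> ^^ i) x) = \<xi> ((\<rho> ^^ i) x)" if "0 < i" "i < n" for i
    using that not_less_Least[of i "\<lambda>n. 0 < n \<and> \<rho> ((\<rho> ^^ n) x) \<noteq> \<xi> ((\<rho> ^^ n) x)"]
    by (auto simp: n_def)
  define l where "l = (\<rho> ^^ n) x"
  have neq: "(\<rho> ^^ i) x \<noteq> d" "(\<rho> ^^ i) x \<noteq> x" if "0 < i" "i < n" for i
    using agree[OF that] d x by metis+
  \<comment> \<open>A map that follows \<open>\<rho>\<close> from \<open>\<rho> x\<close> to
    \<open>l\<close> and then returns to \<open>\<rho> x\<close> never leaves this segment. With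
    \<open>f = \<rho>\<close> this excludes \<open>l = x\<close>, since \<open>d\<close> would be
    missed; with \<open>f = \<xi>\<close> it excludes \<open>l = d\<close>, since \<open>x\<close>
    would be missed.\<close>
  have orbit_agree: "orbit \<rho> x \<subseteq> {y. \<exists>i. 0 < i \<and> i \<le> n \<and> (\<rho> ^^ i) x = y}"
    if "f l = \<rho> x" "orbit f (\<rho> x) = orbit \<rho> x" "\<And>i. 0 < i \<Longrightarrow> i < n \<Longrightarrow> f ((\<rho> ^^ i) x) = \<rho> ((\<rho> ^^ i) x)" for f
    unfolding that(2)[symmetric]
  proof (rule orbit_subset_closed)
    show "\<rho> x \<in> {y. \<exists>i. 0 < i \<and> i \<le> n \<and> (\<rho> ^^ i) x = y}"
      using n(1) by (auto intro!: exI[where x = 1])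
    fix y assume "y \<in> {y. \<exists>i. 0 < i \<and> i \<le> n \<and> (\<rho> ^^ i) x = y}"
    then obtain i where i: "0 < i" "i \<le> n" "(\<rho> ^^ i) x = y"
      by blast
    show "f y \<in> {y. \<exists>i. 0 < i \<and> i \<le> n \<and> (\<rho> ^^ i) x = y}"
    proof (cases "i = n")
      case True
      then have "(\<rho> ^^ 1) x = f y"
        using i that(1) by (simp add: l_def)
      then show ?thesis
        using n(1) by (intro CollectI exI[where x = 1]) simp
    next
      case False
      then have "(\<rho> ^^ Suc i) x = f y"
        using that(3)[of i] i by simp
      then show ?thesis
        using False i(2) by (intro CollectI exI[where x = "Suc i"]) simp
    qed
  qed
  have l: "l \<noteq> x"
  proof
    assume "l = x"
    then have "orbit \<rho> x \<subseteq> {y. \<exists>i. 0 < i \<and> i \<le> n \<and> (\<rho> ^^ i) x = y}"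
      using permutation_orbit_step[OF perm(1)] by (intro orbit_agree) auto
    then obtain i where "0 < i" "i \<le> n" "(\<rho> ^^ i) x = d"
      using orbit_x permutation_self_in_orbit[OF perm(1), of d] by blast
    then show False
      using neq(1)[of i] dx \<open>l = x\<close> by (cases "i = n") (auto simp: l_def)
  qed
  have ld: "l \<noteq> d"
  proof
    assume "l = d"
    have "\<rho> x \<in> arcs G" "tail G (\<rho> x) = tail G d"
      using \<rho>x orbit.base[of \<xi> d] orbit_rotation[OF \<xi> d_arc] by auto
    then have "orbit \<xi> (\<rho> x) = orbit \<rho> x"
      using orbit_rotation[OF \<xi>] orbit_rotation[OF \<rho> d_arc] orbit_x by simp
    then have "orbit \<rho> x \<subseteq> {y. \<exists>i. 0 < i \<and> i \<le> n \<and> (\<rho> ^^ i) x = y}"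
      using agree \<open>l = d\<close> \<rho>x by (intro orbit_agree[of \<xi>]) auto
    then obtain i where "0 < i" "i \<le> n" "(\<rho> ^^ i) x = x"
      using permutation_self_in_orbit[OF perm(1), of x] by blast
    then show False
      using neq(2)[of i] l by (cases "i = n") (auto simp: l_def)
  qed
  have l_orbit: "l \<in> orbit \<rho> x"
    unfolding orbit_altdef l_def using n(1) by blast
  then have l_arc: "l \<in> arcs G"
    using \<open>orbit \<rho> d \<subseteq> arcs G\<close> orbit_x by blast
  \<comment> \<open>The first transposition splits the cycle so that \<open>l\<close> stays with
    \<open>d\<close>; the second one merges the two parts again. So the darts at the vertex still
    form one cycle.\<close>
  define \<rho>1 where "\<rho>1 = \<rho> \<circ> Transposition.transpose d x"
  define \<rho>2 where "\<rho>2 = \<rho>1 \<circ> Transposition.transpose x l"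
  have \<rho>2: "\<rho>2 = \<rho> \<circ> (Transposition.transpose d x \<circ> Transposition.transpose x l)"
    by (simp add: \<rho>2_def \<rho>1_def o_assoc)
  have \<rho>2p: "\<rho>2 permutes arcs G"
    unfolding \<rho>2 using d_arc x_arc l_arc by (intro permutes_compose permutes_swap_id \<rho>p)
  have perm12: "permutation \<rho>1" "permutation \<rho>2"
    using perm by (auto simp: \<rho>1_def \<rho>2_def intro!: permutation_compose permutation_swap_id)
  have xd: "x \<in> orbit \<rho> d"
    using orbit_x permutation_self_in_orbit[OF perm(1), of x] by simp
  have split: "d \<notin> orbit \<rho>1 x" "orbit \<rho>1 d \<union> orbit \<rho>1 x = orbit \<rho> d"
    using orbit_transpose_split[OF perm(1) xd dx] orbit_transpose_split_Un[OF perm(1) xd dx]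
    by (auto simp only: \<rho>1_def)
  have \<rho>1_d: "\<rho>1 d = \<rho> x"
    by (simp add: \<rho>1_def)
  have "(\<rho> ^^ i) x \<in> orbit \<rho>1 d" if "0 < i" "i \<le> n" for i
    using that
  proof (induction i)
    case (Suc i)
    show ?case
    proof (cases "i = 0")
      case True
      then show ?thesis
        using orbit.base[of \<rho>1 d] \<rho>1_d by simp
    next
      case False
      then have "\<rho>1 ((\<rho> ^^ i) x) = \<rho> ((\<rho> ^^ i) x)"
        using neq[of i] Suc.prems by (simp add: \<rho>1_def)
      then show ?thesis
        using orbit.step[OF Suc.IH] False Suc.prems by simp
    qed
  qed simp
  then have "orbit \<rho>1 l = orbit \<rho>1 d"
    using n(1) permutation_orbit_eq[OF perm12(1)] by (simp add: l_def)
  moreover have "l \<notin> orbit \<rho>1 x"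
    using calculation split(1) permutation_orbit_eq[OF perm12(1), of l x]
      permutation_self_in_orbit[OF perm12(1)] by metis
  ultimately have merge: "orbit \<rho>2 x = orbit \<rho> x"
    using orbit_transpose_merge[OF perm12(1), of l x, folded \<rho>2_def] split(2) orbit_x
    by (metis Un_commute)
  have rot: "rotation_system \<rho>2"
  proof (rule rotation_systemI[OF \<rho>2p])
    fix a assume a: "a \<in> arcs G"
    show "orbit \<rho>2 a = out_arcs G (tail G a)"
    proof (cases "a \<in> orbit \<rho> x")
      case True
      then show ?thesis
        using merge permutation_orbit_eq[OF perm12(2), of a x] permutation_orbit_eq[OF perm(1), of a x]
          orbit_rotation[OF \<rho> a] by simp
    next
      case False
      have "orbit \<rho>2 a = orbit \<rho> a"
      proof (rule orbit_cong)
        show "a \<in> orbit \<rho> a"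
          using perm(1) by (rule permutation_self_in_orbit)
        fix s assume "s \<in> orbit \<rho> a"
        then have "s \<notin> orbit \<rho> x"
          using False permutation_orbit_eq[OF perm(1)] \<open>a \<in> orbit \<rho> a\<close> by metis
        then have "s \<noteq> x" "s \<noteq> l" "s \<noteq> d"
          using l_orbit orbit_x permutation_self_in_orbit[OF perm(1)] by metis+
        then show "\<rho>2 s = \<rho> s"
          by (simp add: \<rho>2_def \<rho>1_def)
      qed
      then show ?thesis
        using orbit_rotation[OF \<rho> a] by simp
    qed
  qed
  have \<rho>2_d: "\<rho>2 d = \<xi> d"
    using dx ld \<rho>x by (simp add: \<rho>2_def \<rho>1_def)
  \<comment> \<open>Only the values at \<open>d\<close>, \<open>x\<close> and \<open>l\<close>
    change, and all three were disagreements.\<close>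
  have \<rho>2_other: "\<rho>2 a = \<rho> a" if "\<rho> a = \<xi> a" for a
  proof -
    have "a \<noteq> d" "a \<noteq> x" "a \<noteq> l"
      using that d x n(2) by (auto simp: l_def)
    then show ?thesis
      by (simp add: \<rho>2_def \<rho>1_def)
  qed
  have "{a. \<rho>2 a \<noteq> \<xi> a} \<subset> {a. \<rho> a \<noteq> \<xi> a}"
    using \<rho>2_d \<rho>2_other d by fastforce
  with rot show ?thesis
    using that d_arc x_arc l_arc unfolding \<rho>2 by blast
qed

section \<open>The genus spectrum\<close>

lemma rotation_step:
  assumes \<rho>: "rotation_system \<rho>" and \<xi>: "rotation_system \<xi>" and d: "\<rho> d \<noteq> \<xi> d"
  obtains \<rho>' where "rotation_system \<rho>'" "{a. \<rho>' a \<noteq> \<xi> a} \<subset> {a. \<rho> a \<noteq> \<xi> a}"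
    "\<bar>euler_genus \<rho>' - euler_genus \<rho>\<bar> \<le> 2"
    "euler_genus \<rho>' = euler_genus \<rho> - 2
      \<longrightarrow> corner ((inv \<rho> \<circ> \<xi>) d) \<in> orbit (face_perm \<rho>) (corner d)"
proof -
  let ?x = "(inv \<rho> \<circ> \<xi>) d"
  obtain l where l: "d \<in> arcs G" "?x \<in> arcs G" "l \<in> arcs G"
    and \<rho>': "rotation_system (\<rho> \<circ> (Transposition.transpose d ?x \<circ> Transposition.transpose ?x l))"
      "{a. (\<rho> \<circ> (Transposition.transpose d ?x \<circ> Transposition.transpose ?x l)) a \<noteq> \<xi> a} \<subset> {a. \<rho> a \<noteq> \<xi> a}"
    using rotation_exchange[OF \<rho> \<xi> d] .
  note faces = num_faces_comp_transpose[OF rotation_permutes[OF \<rho>] l]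
  show thesis
  proof (rule that[OF \<rho>'])
    show "\<bar>euler_genus (\<rho> \<circ> (Transposition.transpose d ?x \<circ> Transposition.transpose ?x l)) - euler_genus \<rho>\<bar> \<le> 2"
      using faces(1) unfolding euler_genus_def by linarith
    show "euler_genus (\<rho> \<circ> (Transposition.transpose d ?x \<circ> Transposition.transpose ?x l)) = euler_genus \<rho> - 2
        \<longrightarrow> corner ?x \<in> orbit (face_perm \<rho>) (corner d)"
      unfolding euler_genus_def by (intro impI faces(2)) linarith
  qed
qed

lemma finite_disagreement:
  assumes "rotation_system \<rho>" "rotation_system \<xi>"
  shows "finite {a. \<rho> a \<noteq> \<xi> a}"
proof (rule finite_subset)
  show "{a. \<rho> a \<noteq> \<xi> a} \<subseteq> arcs G"
    using permutes_not_in[OF rotation_permutes[OF assms(1)]] permutes_not_in[OF rotation_permutes[OF assms(2)]]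
    by fastforce
qed simp

text \<open>A path of exchanges from \<open>\<rho>\<close> to \<open>\<xi>\<close> changes the genus
  by at most 2 at a time, so it cannot jump over two consecutive integers.\<close>

lemma genus_spectrum_gap:
  assumes "rotation_system \<rho>" "rotation_system \<xi>" "euler_genus \<xi> < k" "k + 1 < euler_genus \<rho>"
  shows "k \<in> genus_spectrum \<or> k + 1 \<in> genus_spectrum"
  using assms(1,4)
proof (induction "card {a. \<rho> a \<noteq> \<xi> a}" arbitrary: \<rho> rule: less_induct)
  case less
  have "\<rho> \<noteq> \<xi>"
    using assms(3) less.prems(2) by auto
  then obtain d where "\<rho> d \<noteq> \<xi> d"
    by auto
  then obtain \<rho>' where \<rho>': "rotation_system \<rho>'" "{a. \<rho>' a \<noteq> \<xi> a} \<subset> {a. \<rho> a \<noteq> \<xi> a}"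
    "\<bar>euler_genus \<rho>' - euler_genus \<rho>\<bar> \<le> 2"
    using rotation_step[OF less.prems(1) assms(2)] by metis
  have "card {a. \<rho>' a \<noteq> \<xi> a} < card {a. \<rho> a \<noteq> \<xi> a}"
    using finite_disagreement[OF less.prems(1) assms(2)] \<rho>'(2) by (rule psubset_card_mono)
  then have "k \<in> genus_spectrum \<or> k + 1 \<in> genus_spectrum" if "k + 1 < euler_genus \<rho>'"
    using less.hyps \<rho>'(1) that by blast
  moreover have "euler_genus \<rho>' \<in> genus_spectrum"
    using \<rho>'(1) by (auto simp: genus_spectrum_def)
  moreover have "euler_genus \<rho>' = k \<or> euler_genus \<rho>' = k + 1 \<or> k + 1 < euler_genus \<rho>'"
    using \<rho>'(3) less.prems(2) by linarith
  ultimately show ?case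
    by auto
qed

text \<open>Applied to two members of opposite parity below \<open>k\<close>, this shows that
  \<open>k\<close> cannot be a gap once a larger member exists.\<close>

lemma genus_spectrum_parity_below_gap:
  assumes "rotation_system \<rho>" and \<xi>: "rotation_system \<xi>" and k: "k \<notin> genus_spectrum"
    and "euler_genus \<xi> < k" "k < euler_genus \<rho>"
  shows "odd (k - euler_genus \<xi>)"
  using assms(1,5)
proof (induction "card {a. \<rho> a \<noteq> \<xi> a}" arbitrary: \<rho> rule: less_induct)
  case less
  note \<rho> = less.prems(1)
  show ?case
  proof (rule ccontr)
    assume even: "\<not> odd (k - euler_genus \<xi>)"
    \<comment> \<open>If the exchange at \<open>d\<close> stayed above \<open>k\<close>, the
      induction hypothesis would contradict \<open>even\<close>. As \<open>k\<close> is not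
      attained, the exchange must go from \<open>k + 1\<close> to \<open>k - 1\<close>.\<close>
    have step: "euler_genus \<rho> = k + 1 \<and> corner ((inv \<rho> \<circ> \<xi>) d) \<in> orbit (face_perm \<rho>) (corner d)"
      if d: "\<rho> d \<noteq> \<xi> d" for d
    proof -
      obtain \<rho>' where \<rho>': "rotation_system \<rho>'" "{a. \<rho>' a \<noteq> \<xi> a} \<subset> {a. \<rho> a \<noteq> \<xi> a}"
        "\<bar>euler_genus \<rho>' - euler_genus \<rho>\<bar> \<le> 2"
        and corner: "euler_genus \<rho>' = euler_genus \<rho> - 2
          \<longrightarrow> corner ((inv \<rho> \<circ> \<xi>) d) \<in> orbit (face_perm \<rho>) (corner d)"
        by (rule rotation_step[OF \<rho> \<xi> d]) (rule that)
      have "card {a. \<rho>' a \<noteq> \<xi> a} < card {a. \<rho> a \<noteq> \<xi> a}"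
        using finite_disagreement[OF \<rho> \<xi>] \<rho>'(2) by (rule psubset_card_mono)
      then have "\<not> k < euler_genus \<rho>'"
        using less.hyps \<rho>'(1) even by blast
      moreover have "euler_genus \<rho>' \<noteq> k"
        using k \<rho>'(1) by (auto simp: genus_spectrum_def)
      ultimately have "euler_genus \<rho> = k + 1" "euler_genus \<rho>' = euler_genus \<rho> - 2"
        using \<rho>'(3) less.prems(2) by linarith+
      then show ?thesis
        using corner by simp
    qed
    have "\<rho> \<noteq> \<xi>"
      using assms(4) less.prems(2) by auto
    then obtain d where "\<rho> d \<noteq> \<xi> d"
      by auto
    then have genus: "euler_genus \<rho> = k + 1"
      using step by blast
    note \<rho>p = rotation_permutes[OF \<rho>] and \<xi>p = rotation_permutes[OF \<xi>]
    have "even (num_faces (\<rho> \<circ> (inv \<rho> \<circ> \<xi>))) \<longleftrightarrow> even (num_faces \<rho>)"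
    proof (rule even_num_faces_comp[OF \<rho>p])
      show "inv \<rho> \<circ> \<xi> permutes arcs G"
        using \<xi>p permutes_inv[OF \<rho>p] by (rule permutes_compose)
      show "sign (inv \<rho> \<circ> \<xi>) = 1"
        using \<rho> \<xi> by (rule sign_rotation)
      fix d assume "d \<in> arcs G"
      have "(inv \<rho> \<circ> \<xi>) d = d" if "\<rho> d = \<xi> d"
        using permutes_inverses(2)[OF \<rho>p, of d] that by simp
      then show "corner ((inv \<rho> \<circ> \<xi>) d) \<in> orbit (face_perm \<rho>) (corner d)"
        using step[of d] permutation_self_in_orbit[OF
          permutes_permutation[OF face_perm_permutes[OF \<rho>p] finite_states], of "corner d"]
        by (cases "\<rho> d = \<xi> d") (metis, blast)
    qed
    moreover have "\<rho> \<circ> (inv \<rho> \<circ> \<xi>) = \<xi>"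
      using permutes_inv_o(1)[OF \<rho>p] by (simp add: o_assoc)
    \<comment> \<open>The genera of \<open>\<xi>\<close> and \<open>\<rho>\<close> have equal parity
      because their face numbers do, whereas \<open>k + 1\<close> and the genus of
      \<open>\<xi>\<close> have different parity.\<close>
    ultimately have "even (euler_genus \<xi> - euler_genus \<rho>)"
      by (simp add: euler_genus_def)
    then show False
      using even genus by auto
  qed
qed

lemma genus_spectrumE:
  assumes "u \<in> genus_spectrum"
  obtains \<pi> where "rotation_system \<pi>" "u = euler_genus \<pi>"
  using assms by (auto simp: genus_spectrum_def)

lemma finite_genus_spectrum: "finite genus_spectrum"
proof -
  have "genus_spectrum \<subseteq> euler_genus ` {\<pi>. \<pi> permutes arcs G}"
    using rotation_permutes by (auto simp: genus_spectrum_def)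
  then show ?thesis
    by (rule finite_subset) (simp add: finite_permutations)
qed

end

section \<open>Deduction of the shape of the spectrum from the two gap conditions\<close>

lemma spectrum_shape:
  fixes S :: "int set" and \<tau> :: int
  assumes fin: "finite S"
    and gap: "\<And>u w k. u \<in> S \<Longrightarrow> w \<in> S \<Longrightarrow> u < k \<Longrightarrow> k + 1 < w \<Longrightarrow> k \<in> S \<or> k + 1 \<in> S"
    and parity: "\<And>u w k. u \<in> S \<Longrightarrow> w \<in> S \<Longrightarrow> u < k \<Longrightarrow> k < w \<Longrightarrow> k \<notin> S \<Longrightarrow> odd (k - u)"
    and \<tau>: "\<tau> \<in> S" "\<tau> + 1 \<in> S"
    and least: "\<And>t. t \<in> S \<Longrightarrow> t + 1 \<in> S \<Longrightarrow> \<tau> \<le> t"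
  shows "even (\<tau> - Min S)"
    and "S = {x. Min S \<le> x \<and> x \<le> \<tau> \<and> even (x - Min S)} \<union> {\<tau> + 1..Max S}"
proof -
  have "S \<noteq> {}"
    using \<tau>(1) by auto
  have min: "Min S \<in> S" "\<And>x. x \<in> S \<Longrightarrow> Min S \<le> x"
    and max: "Max S \<in> S" "\<And>x. x \<in> S \<Longrightarrow> x \<le> Max S"
    using fin Min_in[OF fin \<open>S \<noteq> {}\<close>] Max_in[OF fin \<open>S \<noteq> {}\<close>] by auto
  \<comment> \<open>Below \<open>\<tau>\<close> no two consecutive integers are members, so
    \<open>?y + 1\<close> is a gap and \<open>gap\<close> makes \<open>?y + 2\<close> a member. The
    upper member is \<open>\<tau> + 1\<close>, because \<open>?y + 2\<close> may be equal to
    \<open>\<tau>\<close>.\<close>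
  have up: "Min S + 2 * int j \<in> S" if "Min S + 2 * int j \<le> \<tau>" for j
    using that
  proof (induction j)
    case (Suc j)
    let ?y = "Min S + 2 * int j"
    have y: "?y \<in> S" "?y + 1 < \<tau>"
      using Suc by auto
    then have "?y + 1 \<notin> S"
      using least[of ?y] by auto
    then have "?y + 2 \<in> S"
      using gap[of ?y "\<tau> + 1" "?y + 1"] y \<tau> by (auto simp: add.assoc)
    then show ?case
      by (simp add: algebra_simps)
  qed (use min in simp)
  have even_in: "x \<in> S" if x: "Min S \<le> x" "x \<le> \<tau>" "even (x - Min S)" for x
  proof -
    obtain m where m: "x - Min S = 2 * m"
      using x(3) by (rule evenE)
    then have "x = Min S + 2 * int (nat m)"
      using x(1) by simp
    then show ?thesis
      using up[of "nat m"] x(2) by simp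
  qed
  \<comment> \<open>A member of the wrong parity would form a consecutive pair with its predecessor,
    which is a member by \<open>even_in\<close>; this pair would start below
    \<open>\<tau>\<close>.\<close>
  have below: "even (x - Min S)" if x: "x \<in> S" "x \<le> \<tau>" for x
  proof (rule ccontr)
    assume odd: "odd (x - Min S)"
    then have "x \<noteq> Min S"
      by auto
    then have "x - 1 \<in> S"
      using min(2)[OF x(1)] x(2) odd by (intro even_in) auto
    then show False
      using least[of "x - 1"] x by auto
  qed
  \<comment> \<open>By \<open>parity\<close>, a gap here would differ in parity from both
    \<open>\<tau>\<close> and \<open>\<tau> + 1\<close>.\<close>
  have above: "x \<in> S" if "\<tau> < x" "x \<le> Max S" for x
  proof (rule ccontr)
    assume "x \<notin> S"
    moreover from this have "x \<noteq> \<tau> + 1" "x \<noteq> Max S"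
      using \<tau> max by auto
    ultimately have "odd (x - \<tau>)" "odd (x - (\<tau> + 1))"
      using parity[of \<tau> "Max S" x] parity[of "\<tau> + 1" "Max S" x] \<tau> max that by auto
    then show False
      by simp
  qed
  show "even (\<tau> - Min S)"
    using below \<tau> by simp
  show "S = {x. Min S \<le> x \<and> x \<le> \<tau> \<and> even (x - Min S)} \<union> {\<tau> + 1..Max S}"
  proof (rule set_eqI)
    fix x
    show "x \<in> S \<longleftrightarrow> x \<in> {x. Min S \<le> x \<and> x \<le> \<tau> \<and> even (x - Min S)} \<union> {\<tau> + 1..Max S}"
      using min(2)[of x] max(2)[of x] below[of x] above[of x] even_in[of x]
      by (cases "x \<le> \<tau>") auto
  qed
qed

theorem theorem1p2:
  fixes G :: "('v, 'd) pre_digraph" and arev :: "'d \<Rightarrow> 'd" and \<sigma> :: "'d \<Rightarrow> int"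
    and S :: "int set" and d \<gamma>\<^sub>M \<tau> :: int
  assumes "signed_graph G arev \<sigma>" and "connected G"
    and "S = signed_graph.genus_spectrum G arev \<sigma>"
    and "d = Min S" and "\<gamma>\<^sub>M = Max S"
    and "\<tau> \<in> S \<and> \<tau> + 1 \<in> S"
    and "\<And>t. t \<in> S \<and> t + 1 \<in> S \<Longrightarrow> \<tau> \<le> t"
  shows "even (\<tau> - d) \<and> S = {x. d \<le> x \<and> x \<le> \<tau> \<and> even (x - d)} \<union> {\<tau> + 1..\<gamma>\<^sub>M}"
proof -
  interpret signed_graph G arev \<sigma>
    by fact
  have S: "S = genus_spectrum"
    by fact
  have gap: "k \<in> S \<or> k + 1 \<in> S" if "u \<in> S" "w \<in> S" "u < k" "k + 1 < w" for u w k
    using that genus_spectrum_gap[of _ _ k] unfolding S by (auto elim!: genus_spectrumE)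
  have parity: "odd (k - u)" if "u \<in> S" "w \<in> S" "u < k" "k < w" "k \<notin> S" for u w k
    using that genus_spectrum_parity_below_gap[of _ _ k] unfolding S by (auto elim!: genus_spectrumE)
  have "finite S"
    unfolding S by (rule finite_genus_spectrum)
  have \<tau>: "\<tau> \<in> S" "\<tau> + 1 \<in> S" "\<And>t. t \<in> S \<Longrightarrow> t + 1 \<in> S \<Longrightarrow> \<tau> \<le> t"
    using assms(6,7) by auto
  show ?thesis
    unfolding \<open>d = Min S\<close> \<open>\<gamma>\<^sub>M = Max S\<close> using spectrum_shape[OF \<open>finite S\<close> gap parity \<tau>] by (rule conjI)
qed

end
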